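(* Consider the problem of maximizing a monotone submodular function subject to a knapsack constraint (MSK), with instances $(E,f,w,W)$ where $|E|=n$. Let $\textsc{EnumGreedy}_2$ be the following algorithm: set $S^*\leftarrow\emptyset$; for every $G\subseteq E$ with $|G|\leq 2$, compute $A\leftarrow \textsc{Greedy}(E,f_G,w,W-w(G))$, and if $f(A\cup G)\geq f(S^* )$ set $S^*\leftarrow A\cup G$; finally return $S^*$. Then $\textsc{EnumGreedy}_2$ is a $(1-e^{-1})$-approximation algorithm for MSK: for every MSK instance it returns a feasible set $S^*$ with $f(S^* )\geq (1-e^{-1})\max\{f(S): S\subseteq E,\ w(S)\leq W\}$. Moreover, it uses $O(n^4)$ value oracle calls and arithmetic operations.
   Context: An MSK instance is a tuple $(E,f,w,W)$ where $E$ is a finite set of $n$ elements, $f:2^E\to\mathbb{R}_{\geq 0}$ is a non-negative, monotone ($f(S)\le f(T)$ for $S\subseteq T$) and submodular ($f(A\cup\{e\})-f(A)\geq f(B\cup\{e\})-f(B)$ for all $A\subseteq B\subseteq E$, $e\in E\setminus B$) set function given by a value oracle, $w:E\to\mathbb{N}_{+}$ is a weight function (positive integers), and $W\in\mathbb{N}$ is the capacity. For $S\subseteq E$, $w(S)=\sum_{e\in S}w(e)$; $S$ is feasible if $w(S)\leq W$; the goal is a feasible $S$ maximizing $f(S)$. For $A\subseteq E$, $f_A:2^E\to\mathbb{R}_{\ge 0}$ is defined by $f_A(S)=f(A\cup S)-f(A)$, and $f(e)$ means $f(\{e\})$. The procedure $\textsc{Greedy}(E,f,w,W)$ is: set $E'\leftarrow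 E$, $A\leftarrow\emptyset$; while $E'\neq\emptyset$: find $e\in E'$ maximizing $f_A(\{e\})/w(e)$ (ties broken arbitrarily), set $E'\leftarrow E'\setminus\{e\}$, and if $w(A\cup\{e\})\leq W$ set $A\leftarrow A\cup\{e\}$; return $A$.
   Formalization: Sets G with w(G) > W are skipped in EnumGreedy_2: for them the capacity W − w(G) is negative, and a literal run (Greedy returning ∅) could return an infeasible set, e.g. E={e}, w(e)=2, W=1, f(∅)=0, f(e)=1. *)

theory Defs
  imports Complex_Main "HOL-Library.Landau_Symbols" "HOL-Library.Monad_Syntax"
begin

definition submodular_on :: "'a set \<Rightarrow> ('a set \<Rightarrow> real) \<Rightarrow> bool" where
  "submodular_on E f \<longleftrightarrow>
    (\<forall>A B. \<forall>e \<in> E - B. A \<subseteq> B \<and> B \<subseteq> E \<longrightarrow>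
      f (A \<union> {e}) - f A \<ge> f (B \<union> {e}) - f B)"

(* f and w are total functions in HOL; only their values on subsets (elements) of E matter. *)
definition msk_instance :: "'a set \<Rightarrow> ('a set \<Rightarrow> real) \<Rightarrow> ('a \<Rightarrow> nat) \<Rightarrow> nat \<Rightarrow> bool" where
  "msk_instance E f w W \<longleftrightarrow>
    finite E \<and> (\<forall>S \<subseteq> E. 0 \<le> f S) \<and> mono_on (Pow E) f \<and> submodular_on E f \<and>
    (\<forall>e \<in> E. 0 < w e)"

definition feasible :: "'a set \<Rightarrow> ('a \<Rightarrow> nat) \<Rightarrow> nat \<Rightarrow> 'a set \<Rightarrow> bool" where
  "feasible E w W S \<longleftrightarrow> S \<subseteq> E \<and> (\<Sum>e\<in>S. w e) \<le> W"

(* A nondeterministic computation: the set of its possible runs (r, q, a), each of which returns r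
   after q value oracle calls and a arithmetic operations (comparisons included). Manipulating
   finite sets and enumerating them is not counted. *)
datatype 'r comp = Comp (runs: "('r \<times> nat \<times> nat) set")

definition ret :: "'r \<Rightarrow> 'r comp" where
  "ret r = Comp {(r, 0, 0)}"

definition bind_comp :: "'r comp \<Rightarrow> ('r \<Rightarrow> 's comp) \<Rightarrow> 's comp" where
  "bind_comp m k =
    Comp {(s, q + q', a + a') | s q a q' a'. \<exists>r. (r, q, a) \<in> runs m \<and> (s, q', a') \<in> runs (k r)}"

adhoc_overloading Monad_Syntax.bind \<rightleftharpoons> bind_comp

definition pick :: "'r set \<Rightarrow> 'r comp" where
  "pick X = Comp {(r, 0, 0) | r. r \<in> X}"

definition value_oracle :: "('a set \<Rightarrow> real) \<Rightarrow> 'a set \<Rightarrow> real comp" where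
  "value_oracle f S = Comp {(f S, 1, 0)}"

(* The argument is the result of a single arithmetic operation or comparison. *)
definition arith :: "'r \<Rightarrow> 'r comp" where
  "arith r = Comp {(r, 0, 1)}"

(* w(S), obtained by card S successive additions starting from 0. *)
definition weight :: "('a \<Rightarrow> nat) \<Rightarrow> 'a set \<Rightarrow> nat comp" where
  "weight w S = Comp {(\<Sum>e\<in>S. w e, 0, card S)}"

lemma bind_comp_cong [fundef_cong]:
  assumes "m = m'" and "\<And>r c. (r, c) \<in> runs m' \<Longrightarrow> k r = k' r"
  shows "bind_comp m k = bind_comp m' k'"
  using assms unfolding bind_comp_def by (metis (no_types, lifting))

primrec scan_max :: "('a \<Rightarrow> real comp) \<Rightarrow> 'a \<Rightarrow> real \<Rightarrow> 'a list \<Rightarrow> 'a comp" where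
  "scan_max d x v [] = ret x"
| "scan_max d x v (y # ys) = do {
     u \<leftarrow> d y;
     better \<leftarrow> arith (v < u);
     if better then scan_max d y u ys else scan_max d x v ys
   }"

(* Linear search for an element of X maximizing d. The scan keeps the first maximizer it meets, and
   the order of inspection is arbitrary, so ties are broken arbitrarily: every maximizer is a
   possible result. *)
definition find_max :: "('a \<Rightarrow> real comp) \<Rightarrow> 'a set \<Rightarrow> 'a comp" where
  "find_max d X = do {
     (x, xs) \<leftarrow> pick {(x, xs). distinct (x # xs) \<and> set (x # xs) = X};
     v \<leftarrow> d x;
     scan_max d x v xs
   }"

(* The oracle S |-> f_A(S) = f(A Un S) - f(A), implemented by two calls to the oracle for f. *)
definition marginal :: "('a set \<Rightarrow> real comp) \<Rightarrow> 'a set \<Rightarrow> 'a set \<Rightarrow> real comp" where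
  "marginal F A S = do {
     x \<leftarrow> F (A \<union> S);
     y \<leftarrow> F A;
     arith (x - y)
   }"

definition density :: "('a set \<Rightarrow> real comp) \<Rightarrow> ('a \<Rightarrow> nat) \<Rightarrow> 'a set \<Rightarrow> 'a \<Rightarrow> real comp" where
  "density F w A e = do {
     x \<leftarrow> marginal F A {e};
     arith (x / real (w e))
   }"

lemma runs_bindE:
  assumes "(s, c) \<in> runs (bind_comp m k)"
  obtains r c1 c2 where "(r, c1) \<in> runs m" and "(s, c2) \<in> runs (k r)"
  using assms by (auto simp: bind_comp_def)

lemma scan_max_mem: "(e, c) \<in> runs (scan_max d x v ys) \<Longrightarrow> e \<in> insert x (set ys)"
proof (induction ys arbitrary: x v c)
  case Nil
  then show ?case by (simp add: ret_def)
next
  case (Cons y ys)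
  from Cons.prems obtain u b c' where
    "(e, c') \<in> runs (if b then scan_max d y u ys else scan_max d x v ys)"
    by (auto elim!: runs_bindE)
  then show ?case
    by (cases b) (auto dest: Cons.IH)
qed

lemma find_max_mem:
  assumes "(e, c) \<in> runs (find_max d X)"
  shows "finite X \<and> e \<in> X"
proof -
  from assms obtain x xs v c' where "set (x # xs) = X" and "(e, c') \<in> runs (scan_max d x v xs)"
    unfolding find_max_def by (auto elim!: runs_bindE simp: pick_def)
  then show ?thesis
    using scan_max_mem by fastforce
qed

(* The while loop of Greedy, from its state (E', A). *)
function greedy_loop ::
  "('a set \<Rightarrow> real comp) \<Rightarrow> ('a \<Rightarrow> nat) \<Rightarrow> nat \<Rightarrow> 'a set \<Rightarrow> 'a set \<Rightarrow> 'a set comp" where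
  "greedy_loop F w W E' A =
    (if E' = {} then ret A
     else do {
       e \<leftarrow> find_max (density F w A) E';
       c \<leftarrow> weight w (A \<union> {e});
       fits \<leftarrow> arith (c \<le> W);
       greedy_loop F w W (E' - {e}) (if fits then A \<union> {e} else A)
     })"
  by pat_completeness auto
termination
  by (relation "measure (\<lambda>(F, w, W, E', A). card E')")
    (auto dest: find_max_mem intro: card_Diff1_less)

declare greedy_loop.simps [simp del]

(* The objective function is accessible only through its oracle F. *)
definition greedy ::
  "'a set \<Rightarrow> ('a set \<Rightarrow> real comp) \<Rightarrow> ('a \<Rightarrow> nat) \<Rightarrow> nat \<Rightarrow> 'a set comp" where
  "greedy E F w W = greedy_loop F w W E {}"

(* Greedy is called with capacity W - w(G), which is a legitimate capacity only if w(G) <= W; sets G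
   with w(G) > W are skipped (A Un G would be infeasible). *)
primrec enum_loop ::
  "'a set \<Rightarrow> ('a set \<Rightarrow> real comp) \<Rightarrow> ('a \<Rightarrow> nat) \<Rightarrow> nat \<Rightarrow> 'a set list \<Rightarrow> 'a set \<Rightarrow> 'a set comp" where
  "enum_loop E F w W [] S = ret S"
| "enum_loop E F w W (G # Gs) S = do {
     c \<leftarrow> weight w G;
     fits \<leftarrow> arith (c \<le> W);
     if fits then do {
       W' \<leftarrow> arith (W - c);
       A \<leftarrow> greedy E (marginal F G) w W';
       x \<leftarrow> F (A \<union> G);
       y \<leftarrow> F S;
       improves \<leftarrow> arith (x \<ge> y);
       enum_loop E F w W Gs (if improves then A \<union> G else S)
     } else enum_loop E F w W Gs S
   }"

definition enum_greedy2 ::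
  "'a set \<Rightarrow> ('a set \<Rightarrow> real comp) \<Rightarrow> ('a \<Rightarrow> nat) \<Rightarrow> nat \<Rightarrow> 'a set comp" where
  "enum_greedy2 E F w W = do {
     Gs \<leftarrow> pick {Gs. distinct Gs \<and> set Gs = {G. G \<subseteq> E \<and> card G \<le> 2}};
     enum_loop E F w W Gs {}
   }"

(* Whatever nondeterministic choices are made, the output must be feasible and alpha-approximate;
   the first conjunct excludes algorithms without any run. *)
definition approximation_algorithm ::
  "real \<Rightarrow> ('a set \<Rightarrow> ('a set \<Rightarrow> real comp) \<Rightarrow> ('a \<Rightarrow> nat) \<Rightarrow> nat \<Rightarrow> 'a set comp) \<Rightarrow> bool" where
  "approximation_algorithm \<alpha> alg \<longleftrightarrow>
    (\<forall>E f w W. msk_instance E f w W \<longrightarrow>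
      runs (alg E (value_oracle f) w W) \<noteq> {} \<and>
      (\<forall>(S, q, a) \<in> runs (alg E (value_oracle f) w W).
        feasible E w W S \<and> f S \<ge> \<alpha> * Max {f T | T. feasible E w W T}))"

(* T n bounds the number of oracle calls plus arithmetic operations of every run on every instance
   with n elements. *)
definition cost_bound ::
  "('a set \<Rightarrow> ('a set \<Rightarrow> real comp) \<Rightarrow> ('a \<Rightarrow> nat) \<Rightarrow> nat \<Rightarrow> 'a set comp) \<Rightarrow> (nat \<Rightarrow> real) \<Rightarrow> bool" where
  "cost_bound alg T \<longleftrightarrow>
    (\<forall>E f w W. msk_instance E f w W \<longrightarrow>
      (\<forall>(S, q, a) \<in> runs (alg E (value_oracle f) w W). real (q + a) \<le> T (card E)))"

end

theory Submission
  imports Defs "HOL-Real_Asymp.Real_Asymp"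
begin

text \<open>
  Let \<open>O\<close> be an optimal set with at least three elements (a smaller one is itself
  enumerated) and let \<open>G = {x, y}\<close> consist of an element \<open>x\<close> of
  \<open>O\<close> of largest value and an element \<open>y\<close> of largest marginal value over
  \<open>{x}\<close>. Let \<open>r\<close> be a heaviest element of \<open>O - G\<close> and
  \<open>Y = O - G - {r}\<close>. As long as the greedy set \<open>A\<close> for
  \<open>f\<^sub>G\<close> has weight at most \<open>W - w(G) - w(r)\<close>, every element of
  \<open>Y\<close> fits, so each accepted element \<open>e\<close> shrinks the gap
  \<open>f\<^sub>G(Y) - f\<^sub>G(A)\<close> by a factor of at most \<open>1 - w(e)/w(Y) \<le> exp
  (- w(e)/w(Y))\<close>. Once the weight exceeds this threshold, it exceeds \<open>w(Y)\<close>, and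
  \<open>f\<^sub>G(A) \<ge> (1 - 1/e) f\<^sub>G(Y)\<close>. The loss incurred by dropping
  \<open>r\<close> is at most \<open>f(G)/2\<close> by the choice of \<open>G\<close>, and the
  surplus \<open>f(G)/e\<close> pays for \<open>(1 - 1/e) f(G)/2\<close> because \<open>e \<le>
  3\<close>.
\<close>

section \<open>Postconditions with cost\<close>

text \<open>Total correctness: some run exists, as \<open>approximation_algorithm\<close> demands,
  and all runs satisfy \<open>Q\<close>. The postcondition sees only \<open>q + a\<close>, the
  quantity limited by \<open>cost_bound\<close>, so existence, correctness and cost are proved in
  one pass.\<close>

definition ensures :: "'r comp \<Rightarrow> ('r \<Rightarrow> nat \<Rightarrow> bool) \<Rightarrow> bool" where
  "ensures m Q \<longleftrightarrow> runs m \<noteq> {} \<and> (\<forall>(r, q, a) \<in> runs m. Q r (q + a))"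

lemma ensures_mono:
  assumes "ensures m P" and "\<And>r t. P r t \<Longrightarrow> Q r t"
  shows "ensures m Q"
  using assms by (auto simp: ensures_def)

lemma ensures_conj:
  "ensures m P \<Longrightarrow> ensures m Q \<Longrightarrow> ensures m (\<lambda>r t. P r t \<and> Q r t)"
  by (auto simp: ensures_def)

lemma ensures_ret: "Q r 0 \<Longrightarrow> ensures (ret r) Q"
  by (simp add: ensures_def ret_def)

lemma ensures_pick:
  assumes "X \<noteq> {}" and "\<And>r. r \<in> X \<Longrightarrow> Q r 0"
  shows "ensures (pick X) Q"
  using assms by (auto simp: ensures_def pick_def)

text \<open>The sequencing rule: the cost \<open>t\<close> already spent becomes an offset in the
  postcondition of the continuation. A run of the whole exists because any run of \<open>m\<close>
  extends by a run of \<open>k r\<close>.\<close>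

lemma ensures_bind:
  assumes m: "ensures m P"
    and k: "\<And>r t. P r t \<Longrightarrow> ensures (k r) (\<lambda>s t'. Q s (t + t'))"
  shows "ensures (bind_comp m k) Q"
proof -
  from m obtain r q a where r: "(r, q, a) \<in> runs m" and "P r (q + a)"
    unfolding ensures_def by fastforce
  then have "ensures (k r) (\<lambda>s t'. Q s (q + a + t'))"
    by (intro k)
  then obtain s q' a' where "(s, q', a') \<in> runs (k r)"
    by (auto simp: ensures_def)
  with r have "(s, q + q', a + a') \<in> runs (bind_comp m k)"
    unfolding bind_comp_def comp.sel mem_Collect_eq by blast
  moreover have "Q s (q + a)" if "(s, q, a) \<in> runs (bind_comp m k)" for s q a
  proof -
    from that obtain r q1 a1 q2 a2 where
      "q = q1 + q2" "a = a1 + a2" "(r, q1, a1) \<in> runs m" and s: "(s, q2, a2) \<in> runs (k r)"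
      by (auto simp: bind_comp_def)
    moreover from this m have "ensures (k r) (\<lambda>s t'. Q s (q1 + a1 + t'))"
      by (intro k) (auto simp: ensures_def)
    ultimately show ?thesis
      by (fastforce simp: ensures_def algebra_simps)
  qed
  ultimately show ?thesis
    by (auto simp: ensures_def)
qed

lemma ensures_bind_arith:
  "ensures (k r) (\<lambda>s t'. Q s (1 + t')) \<Longrightarrow> ensures (bind_comp (arith r) k) Q"
  by (rule ensures_bind[where P = "\<lambda>r' t. r' = r \<and> t = 1"])
    (auto simp: ensures_def arith_def)

lemma ensures_bind_weight:
  "ensures (k (\<Sum>e\<in>S. w e)) (\<lambda>s t'. Q s (card S + t')) \<Longrightarrow> ensures (bind_comp (weight w S) k) Q"
  by (rule ensures_bind[where P = "\<lambda>r' t. r' = (\<Sum>e\<in>S. w e) \<and> t = card S"])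
    (auto simp: ensures_def weight_def)

section \<open>Deterministic oracles and linear search\<close>

text \<open>Captures oracles with a determined answer and an exact price \<open>c\<close>. The
  greedy analysis is thereby independent of how its oracle is built; \<open>c\<close> is 1 for
  \<open>value_oracle\<close> and 3 for \<open>marginal\<close> on top of it.\<close>

definition computes :: "('x \<Rightarrow> 'r comp) \<Rightarrow> ('x \<Rightarrow> 'r) \<Rightarrow> nat \<Rightarrow> bool" where
  "computes F g c \<longleftrightarrow> (\<forall>x. ensures (F x) (\<lambda>r t. r = g x \<and> t = c))"

lemma ensures_bind_computes:
  assumes "computes F g c" and "ensures (k (g x)) (\<lambda>s t'. Q s (c + t'))"
  shows "ensures (bind_comp (F x) k) Q"
proof (rule ensures_bind)
  show "ensures (F x) (\<lambda>r t. r = g x \<and> t = c)"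
    using assms(1) by (simp add: computes_def)
qed (use assms(2) in auto)

lemma computes_value_oracle: "computes (value_oracle f) f 1"
  by (simp add: computes_def ensures_def value_oracle_def)

lemma computes_marginal:
  assumes "computes F g c"
  shows "computes (marginal F A) (\<lambda>S. g (A \<union> S) - g A) (2 * c + 1)"
  unfolding computes_def marginal_def
  by (intro allI ensures_bind_computes[OF assms]) (simp add: ensures_def arith_def)

lemma computes_density:
  assumes "computes F g c"
  shows "computes (density F w A) (\<lambda>e. (g (A \<union> {e}) - g A) / real (w e)) (2 * c + 2)"
  unfolding computes_def density_def
  by (intro allI ensures_bind_computes[OF computes_marginal[OF assms]])
    (simp add: ensures_def arith_def)

text \<open>The stored value is always \<open>h\<close> of the current candidate, so the induction
  varies \<open>x\<close>. Each scanned element costs one evaluation and one comparison.\<close>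

lemma ensures_scan_max:
  assumes "computes d h c"
  shows "ensures (scan_max d x (h x) ys)
    (\<lambda>e t. e \<in> insert x (set ys) \<and> (\<forall>z\<in>insert x (set ys). h z \<le> h e) \<and> t = (c + 1) * length ys)"
proof (induction ys arbitrary: x)
  case Nil
  then show ?case by (simp add: ensures_ret)
next
  case (Cons y ys)
  show ?case
    unfolding scan_max.simps
    by (rule ensures_bind_computes[OF assms], rule ensures_bind_arith)
      (auto intro: ensures_mono[OF Cons.IH])
qed

lemma ensures_find_max:
  assumes d: "computes d h c" and X: "finite X" "X \<noteq> {}"
  shows "ensures (find_max d X)
    (\<lambda>e t. e \<in> X \<and> (\<forall>z\<in>X. h z \<le> h e) \<and> t \<le> (c + 1) * card X)"
  unfolding find_max_def
proof (rule ensures_bind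
    [where P = "\<lambda>p t. p \<in> {(x, xs). distinct (x # xs) \<and> set (x # xs) = X} \<and> t = 0"],
    rule ensures_pick)
  obtain l where l: "set l = X" "distinct l"
    using X finite_distinct_list by blast
  with X obtain x xs where "l = x # xs"
    by (cases l) auto
  with l show "{(x, xs). distinct (x # xs) \<and> set (x # xs) = X} \<noteq> {}"
    by auto
next
  show "p \<in> {(x, xs). distinct (x # xs) \<and> set (x # xs) = X} \<and> (0::nat) = 0"
    if "p \<in> {(x, xs). distinct (x # xs) \<and> set (x # xs) = X}" for p
    using that by simp
next
  fix p :: "'a \<times> 'a list" and t :: nat
  assume p: "p \<in> {(x, xs). distinct (x # xs) \<and> set (x # xs) = X} \<and> t = 0"
  obtain x xs where [simp]: "p = (x, xs)"
    by (cases p)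
  from p have t: "t = 0" and set: "insert x (set xs) = X" and "distinct (x # xs)"
    by auto
  then have card: "card X = Suc (length xs)"
    by (metis distinct_card length_Cons list.simps(15))
  \<comment> \<open>The first element needs no comparison, so the exact cost is one less than the
    stated bound.\<close>
  have "ensures (d x \<bind> (\<lambda>v. scan_max d x v xs))
    (\<lambda>e t'. e \<in> X \<and> (\<forall>z\<in>X. h z \<le> h e) \<and> t' \<le> (c + 1) * card X)"
    by (rule ensures_bind_computes[OF d], rule ensures_mono[OF ensures_scan_max[OF d]])
      (auto simp: set card)
  then show "ensures (case p of (x, xs) \<Rightarrow> d x \<bind> (\<lambda>v. scan_max d x v xs))
    (\<lambda>e t'. e \<in> X \<and> (\<forall>z\<in>X. h z \<le> h e) \<and> t + t' \<le> (c + 1) * card X)"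
    by (simp add: t)
qed

section \<open>The greedy loop\<close>

text \<open>One iteration, leaving the recursive call to the caller; the cost proof and the value
  proof share it. The bound on \<open>t\<close> adds the search at density price
  \<open>2 * c + 2\<close>, the weight computation and the capacity test.\<close>

lemma ensures_greedy_loop_step:
  assumes F: "computes F g c" and E': "finite E'" "E' \<noteq> {}"
    and step: "\<And>e t. e \<in> E' \<Longrightarrow>
      (\<And>z. z \<in> E' \<Longrightarrow>
        (g (A \<union> {z}) - g A) / real (w z) \<le> (g (A \<union> {e}) - g A) / real (w e)) \<Longrightarrow>
      t \<le> (2 * c + 3) * card E' + card (A \<union> {e}) + 1 \<Longrightarrow>
      ensures (greedy_loop F w W (E' - {e}) (if sum w (A \<union> {e}) \<le> W then A \<union> {e} else A))
        (\<lambda>S t'. Q S (t + t'))"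
  shows "ensures (greedy_loop F w W E' A) Q"
proof -
  have "ensures (find_max (density F w A) E' \<bind> (\<lambda>e. weight w (A \<union> {e}) \<bind> (\<lambda>k. arith (k \<le> W) \<bind>
    (\<lambda>fits. greedy_loop F w W (E' - {e}) (if fits then A \<union> {e} else A))))) Q"
  proof (rule ensures_bind[OF ensures_find_max[OF computes_density[OF F] E']])
    fix e t
    assume e: "e \<in> E' \<and> (\<forall>z\<in>E'. (g (A \<union> {z}) - g A) / real (w z) \<le>
        (g (A \<union> {e}) - g A) / real (w e)) \<and> t \<le> (2 * c + 2 + 1) * card E'"
    have "ensures (greedy_loop F w W (E' - {e}) (if sum w (A \<union> {e}) \<le> W then A \<union> {e} else A))
      (\<lambda>S t'. Q S (t + card (A \<union> {e}) + 1 + t'))"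
      using e by (intro step) (auto simp: algebra_simps)
    then show "ensures (weight w (A \<union> {e}) \<bind> (\<lambda>k. arith (k \<le> W) \<bind>
      (\<lambda>fits. greedy_loop F w W (E' - {e}) (if fits then A \<union> {e} else A)))) (\<lambda>S t'. Q S (t + t'))"
      by (intro ensures_bind_weight ensures_bind_arith) (simp only: add.assoc)
  qed
  with E' show ?thesis
    by (subst greedy_loop.simps) simp
qed

text \<open>Every iteration removes one element of \<open>E'\<close> and costs at most
  \<open>(2 * c + 4) * card E + 1\<close>. The conclusion \<open>A \<subseteq> S\<close> lets value
  bounds for an intermediate set carry over to the output.\<close>

lemma greedy_loop_feasible_cost:
  assumes F: "computes F g c" and "finite E" and "A \<subseteq> E" and "E' \<subseteq> E" and "sum w A \<le> W"
  shows "ensures (greedy_loop F w W E' A)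
    (\<lambda>S t. A \<subseteq> S \<and> S \<subseteq> E \<and> sum w S \<le> W \<and> t \<le> card E' * ((2 * c + 4) * card E + 1))"
  using assms(3-)
proof (induction "card E'" arbitrary: E' A)
  case 0
  with \<open>finite E\<close> have "E' = {}"
    by (auto simp: finite_subset)
  with 0 show ?case
    by (subst greedy_loop.simps) (simp add: ensures_ret)
next
  case (Suc k)
  note fin = finite_subset[OF Suc.prems(2) \<open>finite E\<close>]
  from Suc.hyps have "E' \<noteq> {}"
    by auto
  show ?case
  proof (rule ensures_greedy_loop_step[OF F fin \<open>E' \<noteq> {}\<close>])
    fix e t
    assume e: "e \<in> E'" and t: "t \<le> (2 * c + 3) * card E' + card (A \<union> {e}) + 1"
    let ?A = "if sum w (A \<union> {e}) \<le> W then A \<union> {e} else A"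
    have "(2 * c + 3) * card E' \<le> (2 * c + 3) * card E" "card (A \<union> {e}) \<le> card E"
      using Suc.prems \<open>finite E\<close> e by (auto intro!: mult_left_mono card_mono)
    with t have t': "t \<le> (2 * c + 4) * card E + 1"
      by (simp add: algebra_simps)
    have k: "k = card (E' - {e})"
      using Suc.hyps(2) e fin by simp
    have "ensures (greedy_loop F w W (E' - {e}) ?A)
      (\<lambda>S t. ?A \<subseteq> S \<and> S \<subseteq> E \<and> sum w S \<le> W \<and>
        t \<le> card (E' - {e}) * ((2 * c + 4) * card E + 1))"
      using Suc.prems e by (intro Suc.hyps(1)[OF k]) auto
    then show "ensures (greedy_loop F w W (E' - {e}) ?A)
      (\<lambda>S t'. A \<subseteq> S \<and> S \<subseteq> E \<and> sum w S \<le> W \<and>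
        t + t' \<le> card E' * ((2 * c + 4) * card E + 1))"
    proof (rule ensures_mono)
      fix S t2
      assume *: "?A \<subseteq> S \<and> S \<subseteq> E \<and> sum w S \<le> W \<and>
        t2 \<le> card (E' - {e}) * ((2 * c + 4) * card E + 1)"
      then have "t + t2 \<le> Suc k * ((2 * c + 4) * card E + 1)"
        using t' by (simp add: k[symmetric])
      with * show "A \<subseteq> S \<and> S \<subseteq> E \<and> sum w S \<le> W \<and>
        t + t2 \<le> card E' * ((2 * c + 4) * card E + 1)"
        by (auto simp: Suc.hyps(2) split: if_splits)
    qed
  qed
qed

section \<open>Exponential decay of the gap to a comparison set\<close>

text \<open>Insert the elements of \<open>Y\<close> one by one: by submodularity each gain is at
  most the gain over \<open>A\<close> alone, and elements of \<open>A\<close> gain nothing.\<close>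

lemma submodular_gain_le_sum:
  assumes sub: "submodular_on E g" and "finite Y" and "A \<subseteq> E" and "Y \<subseteq> E"
  shows "g (A \<union> Y) - g A \<le> (\<Sum>y\<in>Y. g (A \<union> {y}) - g A)"
  using \<open>finite Y\<close> \<open>Y \<subseteq> E\<close>
proof (induction Y rule: finite_induct)
  case empty
  then show ?case by simp
next
  case (insert y Y)
  have "g (A \<union> Y \<union> {y}) - g (A \<union> Y) \<le> g (A \<union> {y}) - g A"
  proof (cases "y \<in> A")
    case True
    then show ?thesis by (simp add: insert_absorb)
  next
    case False
    with insert \<open>A \<subseteq> E\<close> sub[unfolded submodular_on_def, rule_format, of y "A \<union> Y" A]
    show ?thesis by auto
  qed
  with insert show ?case by simp
qed

text \<open>By averaging over \<open>Y\<close>, the best density is at least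
  \<open>(g Y - g A) / w(Y)\<close>, so accepting \<open>e\<close> closes at least the fraction
  \<open>w(e) / w(Y)\<close> of the gap. The estimate \<open>1 - x <= exp (- x)\<close> turns
  successive factors into an exponential in the total weight of \<open>A\<close>.\<close>

lemma greedy_step_gap:
  fixes w :: "'a \<Rightarrow> nat"
  assumes mono: "mono_on (Pow E) g" and sub: "submodular_on E g" and fin: "finite E"
    and pos: "\<And>e. e \<in> E \<Longrightarrow> 0 < w e"
    and AE: "A \<subseteq> E" and YE: "Y \<subseteq> E" and Y: "Y \<noteq> {}" and e: "e \<in> E" "e \<notin> A"
    and dense: "\<And>z. z \<in> Y - A \<Longrightarrow>
        (g (A \<union> {z}) - g A) / real (w z) \<le> (g (A \<union> {e}) - g A) / real (w e)"
    and D: "0 \<le> D" and gap: "g Y - g A \<le> exp (- (sum w A / sum w Y)) * D"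
  shows "g Y - g (A \<union> {e}) \<le> exp (- (sum w (A \<union> {e}) / sum w Y)) * D"
\<comment> \<open>A closed gap is trivial. Otherwise \<open>g A <= g (A Un {e}) < g Y\<close>, and
  this sign is needed to multiply \<open>1 - x <= exp (- x)\<close> by
  \<open>g Y - g A\<close>.\<close>
proof (cases "g Y \<le> g (A \<union> {e})")
  case True
  moreover have "0 \<le> exp (- (sum w (A \<union> {e}) / sum w Y)) * D"
    using D by simp
  ultimately show ?thesis by linarith
next
  case False
  define \<rho> where "\<rho> = (g (A \<union> {e}) - g A) / real (w e)"
  have finA: "finite A" and finY: "finite Y"
    using AE YE fin by (auto intro: finite_subset)
  have incr: "g A \<le> g (A \<union> {z})" if "z \<in> E" for z
    using mono_onD[OF mono, of A "A \<union> {z}"] that AE by auto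
  have \<rho>: "0 \<le> \<rho>" and we: "0 < w e"
    using incr[OF e(1)] pos[OF e(1)] by (auto simp: \<rho>_def)
  have "0 < sum w Y"
    by (intro sum_pos finY Y) (meson pos YE subsetD)
  then have wY: "0 < real (sum w Y)"
    by (rule of_nat_0_less_iff[THEN iffD2])
  have "g Y \<le> g (A \<union> Y)"
    using mono_onD[OF mono, of Y "A \<union> Y"] AE YE by auto
  then have "g Y - g A \<le> (\<Sum>y\<in>Y. g (A \<union> {y}) - g A)"
    using submodular_gain_le_sum[OF sub finY AE YE] by linarith
  also have "\<dots> \<le> (\<Sum>y\<in>Y. real (w y) * \<rho>)"
  proof (rule sum_mono)
    fix y assume y: "y \<in> Y"
    show "g (A \<union> {y}) - g A \<le> real (w y) * \<rho>"
    proof (cases "y \<in> A")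
      case True
      then show ?thesis using \<rho> by (simp add: insert_absorb)
    next
      case False
      with dense[of y] y pos[of y] YE show ?thesis
        unfolding \<rho>_def[symmetric] by (auto simp: pos_divide_le_eq mult.commute)
    qed
  qed
  also have "\<dots> = real (sum w Y) * \<rho>"
    by (simp add: sum_distrib_right)
  finally have "(g Y - g A) / real (sum w Y) \<le> \<rho>"
    using wY by (simp add: pos_divide_le_eq mult.commute)
  then have "real (w e) * ((g Y - g A) / real (sum w Y)) \<le> real (w e) * \<rho>"
    by (intro mult_left_mono) auto
  also have "\<dots> = g (A \<union> {e}) - g A"
    using we by (simp add: \<rho>_def)
  finally have "g Y - g (A \<union> {e}) \<le> (1 - real (w e) / real (sum w Y)) * (g Y - g A)"
    by (simp add: algebra_simps)
  also have "\<dots> \<le> exp (- (real (w e) / real (sum w Y))) * (g Y - g A)"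
    using False incr[OF e(1)] exp_ge_add_one_self[of "- (real (w e) / real (sum w Y))"]
    by (intro mult_right_mono) auto
  also have "\<dots> \<le> exp (- (real (w e) / real (sum w Y))) *
      (exp (- (real (sum w A) / real (sum w Y))) * D)"
    using gap by (intro mult_left_mono) auto
  also have "\<dots> = exp (- (real (sum w (A \<union> {e})) / real (sum w Y))) * D"
    using e finA by (simp add: exp_add[symmetric] add_divide_distrib mult.assoc[symmetric])
  finally show ?thesis .
qed

text \<open>The invariant is the decay bound together with
  \<open>Y \<subseteq> A \<union> E'\<close>, which says that no element of \<open>Y\<close> has
  been rejected. It lasts while \<open>w(A) + m <= W\<close>; afterwards \<open>w(A)\<close> exceeds
  \<open>w(Y)\<close> and the decay bound already suffices.\<close>

lemma greedy_loop_value: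
  fixes w :: "'a \<Rightarrow> nat"
  assumes F: "computes F g c" and mono: "mono_on (Pow E) g" and sub: "submodular_on E g"
    and fin: "finite E" and pos: "\<And>e. e \<in> E \<Longrightarrow> 0 < w e"
    and YE: "Y \<subseteq> E" and m: "\<And>y. y \<in> Y \<Longrightarrow> w y \<le> m" and wY: "sum w Y + m \<le> W"
    and D: "0 \<le> D"
    and "A \<subseteq> E" "E' \<subseteq> E" "A \<inter> E' = {}" "Y \<subseteq> A \<union> E'" "sum w A \<le> W"
    and "g Y - g A \<le> exp (- (sum w A / sum w Y)) * D"
  shows "ensures (greedy_loop F w W E' A) (\<lambda>S t. g Y - g S \<le> exp (- 1) * D)"
  using assms(10-)
proof (induction "card E'" arbitrary: E' A rule: less_induct)
  case less
  \<comment> \<open>The output contains \<open>A\<close>, so by monotonicity a bound reached at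
    \<open>A\<close> is final and the rest of the loop can be ignored.\<close>
  note superset = ensures_mono[OF greedy_loop_feasible_cost
      [OF F fin less.prems(1) less.prems(2) less.prems(5)]]
  have mono': "g S \<le> g T" if "S \<subseteq> T" "T \<subseteq> E" for S T
    using mono_onD[OF mono, of S T] that by auto
  show ?case
  proof (cases "Y \<subseteq> A")
    case True
    then show ?thesis
      using D by (intro superset) (smt (verit) exp_ge_zero mono' mult_nonneg_nonneg order_trans)
  next
    case not_covered: False
    show ?thesis
    proof (cases "sum w A + m \<le> W")
      \<comment> \<open>The threshold is passed: \<open>w(A) > W - m >= w(Y)\<close>, so the
        exponent is at most -1.\<close>
      case False
      have "Y \<noteq> {}"
        using not_covered by auto
      moreover have "0 < w y" if "y \<in> Y" for y
        using pos YE that by blast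
      ultimately have "0 < sum w Y"
        by (intro sum_pos finite_subset[OF YE fin])
      moreover have "sum w Y \<le> sum w A"
        using False wY by linarith
      ultimately have "1 \<le> real (sum w A) / real (sum w Y)"
        by (simp only: le_divide_eq_1_pos of_nat_0_less_iff of_nat_le_iff)
      then have "exp (- (real (sum w A) / real (sum w Y))) * D \<le> exp (- 1) * D"
        using D by (intro mult_right_mono) auto
      with less.prems(6) have "g Y - g A \<le> exp (- 1) * D"
        by linarith
      then show ?thesis
        by (intro superset) (smt (verit) mono')
    next
      case True
      have finE': "finite E'"
        using less.prems(2) fin finite_subset by blast
      have "E' \<noteq> {}"
        using not_covered less.prems(4) by auto
      show ?thesis
      proof (rule ensures_greedy_loop_step[OF F finE' \<open>E' \<noteq> {}\<close>])
        fix e t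
        assume e: "e \<in> E'" and dense: "\<And>z. z \<in> E' \<Longrightarrow>
          (g (A \<union> {z}) - g A) / real (w z) \<le> (g (A \<union> {e}) - g A) / real (w e)"
        have smaller: "card (E' - {e}) < card E'"
          using e finE' by (meson card_Diff1_less)
        have "e \<notin> A"
          using e less.prems(3) by auto
        then have sum_insert: "sum w (A \<union> {e}) = sum w A + w e"
          using less.prems(1) fin by (simp add: finite_subset)
        show "ensures (greedy_loop F w W (E' - {e})
            (if sum w (A \<union> {e}) \<le> W then A \<union> {e} else A))
          (\<lambda>S t'. g Y - g S \<le> exp (- 1) * D)"
        proof (cases "sum w (A \<union> {e}) \<le> W")
          case fits: True
          have "g Y - g (A \<union> {e}) \<le> exp (- (sum w (A \<union> {e}) / sum w Y)) * D"
            using not_covered less.prems e \<open>e \<notin> A\<close>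
            by (intro greedy_step_gap[OF mono sub fin pos _ YE _ _ _ dense D]) auto
          with fits show ?thesis
            using less.prems e by (simp only: if_True, intro less.hyps[OF smaller]) auto
        next
          case rejected: False
          \<comment> \<open>Rejection with \<open>w(A) + m <= W\<close> forces
            \<open>w e > m\<close>, which no element of \<open>Y\<close> satisfies; the invariant
            survives.\<close>
          then have "e \<notin> Y"
            using sum_insert True m[of e] by auto
          with rejected show ?thesis
            using less.prems e by (simp only: if_False, intro less.hyps[OF smaller]) auto
        qed
      qed
    qed
  qed
qed

section \<open>Greedy on the marginal function of a guessed set\<close>

lemma marginal_mono_submodular:
  assumes mono: "mono_on (Pow E) f" and sub: "submodular_on E f" and G: "G \<subseteq> E"
  shows "mono_on (Pow E) (\<lambda>S. f (G \<union> S) - f G)" and "submodular_on E (\<lambda>S. f (G \<union> S) - f G)"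
proof -
  show "mono_on (Pow E) (\<lambda>S. f (G \<union> S) - f G)"
  proof (rule mono_onI)
    fix S T assume "S \<in> Pow E" "T \<in> Pow E" "S \<le> T"
    then have "f (G \<union> S) \<le> f (G \<union> T)"
      using G by (intro mono_onD[OF mono]) auto
    then show "f (G \<union> S) - f G \<le> f (G \<union> T) - f G" by simp
  qed
  have "f (G \<union> (B \<union> {e})) - f (G \<union> B) \<le> f (G \<union> (A \<union> {e})) - f (G \<union> A)"
    if "e \<in> E - B" "A \<subseteq> B" "B \<subseteq> E" for A B e
  proof (cases "e \<in> G")
    case True
    then show ?thesis by (simp add: insert_absorb)
  next
    case False
    with that G sub[unfolded submodular_on_def, rule_format, of e "G \<union> B" "G \<union> A"]
    show ?thesis by auto
  qed
  then show "submodular_on E (\<lambda>S. f (G \<union> S) - f G)"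
    by (auto simp: submodular_on_def)
qed

text \<open>The constant 10 is \<open>2 * c + 4\<close> for the marginal oracle, whose price is
  \<open>c = 3\<close>.\<close>

lemma greedy_marginal_feasible_cost:
  assumes "finite E"
  shows "ensures (greedy E (marginal (value_oracle f) G) w W)
    (\<lambda>A t. A \<subseteq> E \<and> sum w A \<le> W \<and> t \<le> card E * (10 * card E + 1))"
  unfolding greedy_def
  using greedy_loop_feasible_cost[OF computes_marginal[OF computes_value_oracle] assms, of "{}" E w W]
  by (rule ensures_mono) auto

text \<open>The loop starts at the empty set, where the marginal function vanishes, so the initial
  gap is \<open>D = f (G Un Y) - f G\<close>. Here \<open>W\<close> is the residual capacity,
  whereas \<open>W'\<close> belongs to the original instance.\<close>

lemma greedy_marginal_value:
  assumes msk: "msk_instance E f w W'" and G: "G \<subseteq> E"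
    and Y: "Y \<subseteq> E" "\<And>y. y \<in> Y \<Longrightarrow> w y \<le> m" "sum w Y + m \<le> W"
  shows "ensures (greedy E (marginal (value_oracle f) G) w W)
    (\<lambda>A t. f G + (1 - exp (- 1)) * (f (G \<union> Y) - f G) \<le> f (A \<union> G))"
proof -
  from msk have mono: "mono_on (Pow E) f" and sub: "submodular_on E f" and fin: "finite E"
    and pos: "\<And>e. e \<in> E \<Longrightarrow> 0 < w e"
    by (auto simp: msk_instance_def)
  have "f G \<le> f (G \<union> Y)"
    using G Y by (intro mono_onD[OF mono]) auto
  then have "ensures (greedy_loop (marginal (value_oracle f) G) w W E {})
    (\<lambda>S t. (f (G \<union> Y) - f G) - (f (G \<union> S) - f G) \<le> exp (- 1) * (f (G \<union> Y) - f G))"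
    using Y by (intro greedy_loop_value[OF computes_marginal[OF computes_value_oracle]
      marginal_mono_submodular[OF mono sub G] fin pos]) auto
  then show ?thesis
    unfolding greedy_def by (rule ensures_mono) (auto simp: algebra_simps Un_commute)
qed

section \<open>Enumeration\<close>

lemma finite_ex_maximizer:
  fixes h :: "'a \<Rightarrow> 'b::linorder"
  assumes "finite X" and "X \<noteq> {}"
  shows "\<exists>x\<in>X. \<forall>z\<in>X. h z \<le> h x"
proof -
  have "Max (h ` X) \<in> h ` X"
    using assms by (intro Max_in) auto
  then obtain x where "x \<in> X" "Max (h ` X) = h x"
    by auto
  with assms show ?thesis
    by (metis Max_ge finite_imageI imageI)
qed

text \<open>\<open>G\<close> may depend on the unknown set \<open>O'\<close>, because the algorithm
  tries every candidate of size at most 2.\<close>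

lemma exists_good_pair:
  assumes msk: "msk_instance E f w W" and opt: "feasible E w W O'"
  obtains G where "G \<subseteq> E" "card G \<le> 2" "sum w G \<le> W"
    "ensures (greedy E (marginal (value_oracle f) G) w (W - sum w G))
      (\<lambda>A t. (1 - exp (- 1)) * f O' \<le> f (A \<union> G))"
proof -
  from msk have mono: "\<And>S T. S \<subseteq> T \<Longrightarrow> T \<subseteq> E \<Longrightarrow> f S \<le> f T" and nonneg: "\<And>S. S \<subseteq> E \<Longrightarrow> 0 \<le> f S"
    and fin: "finite E"
    by (auto simp: msk_instance_def intro: mono_onD)
  from msk have sub: "f (B \<union> {e}) - f B \<le> f (A \<union> {e}) - f A"
    if "e \<in> E - B" "A \<subseteq> B" "B \<subseteq> E" for A B e
    using that by (simp add: msk_instance_def submodular_on_def)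
  from opt have OE: "O' \<subseteq> E" and wO: "sum w O' \<le> W"
    by (auto simp: feasible_def)
  have finO: "finite O'"
    using OE fin finite_subset by blast
  show ?thesis
  proof (cases "card O' \<le> 2")
    \<comment> \<open>\<open>O'\<close> itself is a guess, and adding the greedy set cannot lower
      its value.\<close>
    case True
    have "ensures (greedy E (marginal (value_oracle f) O') w (W - sum w O'))
      (\<lambda>A t. (1 - exp (- 1)) * f O' \<le> f (A \<union> O'))"
    proof (rule ensures_mono[OF greedy_marginal_feasible_cost[OF fin]])
      fix A t assume "A \<subseteq> E \<and> sum w A \<le> W - sum w O' \<and> t \<le> card E * (10 * card E + 1)"
      then have "f O' \<le> f (A \<union> O')"
        using OE by (intro mono) auto
      moreover have "0 \<le> exp (- 1) * f O'"
        using nonneg[OF OE] by simp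
      ultimately show "(1 - exp (- 1)) * f O' \<le> f (A \<union> O')"
        by (simp add: algebra_simps)
    qed
    with True OE wO show ?thesis
      using that by blast
  next
    case False
    then have "O' \<noteq> {}" by auto
    obtain x where x: "x \<in> O'" and x_max: "\<And>z. z \<in> O' \<Longrightarrow> f {z} \<le> f {x}"
      using finite_ex_maximizer[OF finO \<open>O' \<noteq> {}\<close>, of "\<lambda>z. f {z}"] by blast
    have "card (O' - {x}) = card O' - 1"
      using x by simp
    with False have nonempty: "O' - {x} \<noteq> {}"
      by force
    obtain y where y: "y \<in> O' - {x}"
        and y_max: "\<And>z. z \<in> O' - {x} \<Longrightarrow> f {x, z} \<le> f {x, y}"
      using finite_ex_maximizer[OF finite_Diff[OF finO] nonempty, of "\<lambda>z. f {x, z}"] by blast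
    define G where "G = {x, y}"
    have "card (O' - G) = card O' - 2"
      using x y finO by (auto simp: G_def card_Diff_subset)
    with False have nonempty: "O' - G \<noteq> {}"
      by force
    obtain r where r: "r \<in> O' - G" and r_max: "\<And>z. z \<in> O' - G \<Longrightarrow> w z \<le> w r"
      using finite_ex_maximizer[OF finite_Diff[OF finO] nonempty, of w] by blast
    define Y where "Y = O' - G - {r}"
    have O_eq: "O' = G \<union> Y \<union> {r}" and rYG: "r \<notin> G \<union> Y" and GY: "G \<inter> Y = {}"
      using x y r by (auto simp: G_def Y_def)
    have fins: "finite G" "finite Y"
      using finO by (auto simp: G_def Y_def)
    have sum_O: "sum w O' = sum w G + (sum w Y + w r)"
      using rYG GY fins by (subst O_eq) (simp add: sum.union_disjoint)
    have GE: "G \<subseteq> E" and YE: "Y \<subseteq> E" and rE: "r \<in> E"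
      using OE O_eq by auto
    \<comment> \<open>The loss from dropping \<open>r\<close> is bounded twice: over
      \<open>{x}\<close> by the choice of \<open>y\<close>, over \<open>{}\<close> by the choice of
      \<open>x\<close>. The two bounds add up to \<open>f G\<close>, so the loss is at most half of
      it.\<close>
    have "f O' - f (G \<union> Y) \<le> f {x, r} - f {x}"
      using sub[of r "G \<union> Y" "{x}"] rYG GE YE rE by (simp add: O_eq G_def insert_commute)
    also have "\<dots> \<le> f {x, y} - f {x}"
      using y_max[of r] r by (auto simp: G_def)
    finally have loss1: "f O' - f (G \<union> Y) \<le> f G - f {x}"
      by (simp add: G_def)
    have "f O' - f (G \<union> Y) \<le> f {r} - f {}"
      using sub[of r "G \<union> Y" "{}"] rYG GE YE rE by (simp add: O_eq)
    also have "\<dots> \<le> f {x}"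
      using x_max[of r] r nonneg[of "{}"] by auto
    finally have loss: "f O' - f (G \<union> Y) \<le> f G / 2"
      using loss1 by linarith
    \<comment> \<open>Equivalent to \<open>3 / 2 * (1 - exp (- 1)) <= 1\<close>, the coefficient of
      \<open>f G\<close> below.\<close>
    have e1: "1 / 3 \<le> exp (- 1 :: real)"
      using exp_le by (simp add: exp_minus field_simps)
    have e2: "0 \<le> 1 - exp (- 1 :: real)"
      by simp
    have "(1 - exp (- 1)) * f O' \<le> (1 - exp (- 1)) * (f (G \<union> Y) + f G / 2)"
      using loss by (intro mult_left_mono[OF _ e2]) auto
    also have "\<dots> = (1 - exp (- 1)) * (f (G \<union> Y) - f G) + (3 / 2 * (1 - exp (- 1))) * f G"
      by (simp add: field_simps)
    also have "\<dots> \<le> (1 - exp (- 1)) * (f (G \<union> Y) - f G) + 1 * f G"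
      using e1 nonneg[OF GE] by (intro add_left_mono mult_right_mono) auto
    finally have approx: "(1 - exp (- 1)) * f O' \<le> f G + (1 - exp (- 1)) * (f (G \<union> Y) - f G)"
      by simp
    have "ensures (greedy E (marginal (value_oracle f) G) w (W - sum w G))
      (\<lambda>A t. f G + (1 - exp (- 1)) * (f (G \<union> Y) - f G) \<le> f (A \<union> G))"
      \<comment> \<open>Here \<open>m\<close> is \<open>w r\<close>: \<open>r\<close> is heaviest
        outside \<open>G\<close>, and \<open>Y\<close> with \<open>r\<close> fits into the capacity
        left by \<open>G\<close>.\<close>
      using wO sum_O r_max by (intro greedy_marginal_value[OF msk GE YE]) (auto simp: Y_def)
    then have "ensures (greedy E (marginal (value_oracle f) G) w (W - sum w G))
      (\<lambda>A t. (1 - exp (- 1)) * f O' \<le> f (A \<union> G))"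
      by (rule ensures_mono) (use approx in linarith)
    moreover have "card G \<le> 2"
      by (simp add: G_def card_insert_if)
    moreover have "sum w G \<le> W"
      using sum_O wO by linarith
    ultimately show ?thesis
      using that GE by blast
  qed
qed

text \<open>The incumbent never loses value, so the guarantee \<open>v G\<close> of each processed
  guess persists to the end. Besides \<open>k\<close> for greedy, a guess costs at most 7: two
  additions for its weight, the capacity test, the subtraction, two oracle calls and the final
  comparison.\<close>

lemma ensures_enum_loop:
  fixes v :: "'a set \<Rightarrow> real"
  assumes fin: "finite E"
    and Gs: "\<And>G. G \<in> set Gs \<Longrightarrow> G \<subseteq> E \<and> card G \<le> 2"
    and greedy: "\<And>G. G \<in> set Gs \<Longrightarrow> sum w G \<le> W \<Longrightarrow>
      ensures (greedy E (marginal (value_oracle f) G) w (W - sum w G))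
        (\<lambda>A t. A \<subseteq> E \<and> sum w A \<le> W - sum w G \<and> t \<le> k \<and> v G \<le> f (A \<union> G))"
    and S: "feasible E w W S"
  shows "ensures (enum_loop E (value_oracle f) w W Gs S)
    (\<lambda>R t. feasible E w W R \<and> f S \<le> f R \<and> (\<forall>G\<in>set Gs. sum w G \<le> W \<longrightarrow> v G \<le> f R) \<and>
      t \<le> length Gs * (k + 7))"
  using Gs greedy S
proof (induction Gs arbitrary: S)
  case Nil
  then show ?case by (simp add: ensures_ret)
next
  case (Cons G Gs)
  have cardG: "card G \<le> 2" and GE: "G \<subseteq> E"
    using Cons.prems(1)[of G] by auto
  note IH = ensures_mono[OF Cons.IH[OF Cons.prems(1,2)]]
  show ?case
  proof (cases "sum w G \<le> W")
    case False
    have "ensures (enum_loop E (value_oracle f) w W Gs S)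
      (\<lambda>R t'. feasible E w W R \<and> f S \<le> f R \<and>
        (\<forall>G\<in>set (G # Gs). sum w G \<le> W \<longrightarrow> v G \<le> f R) \<and>
        card G + (1 + t') \<le> length (G # Gs) * (k + 7))"
      by (rule IH) (use Cons.prems(3) cardG False in auto)
    with False show ?thesis
      unfolding enum_loop.simps
      by (intro ensures_bind_weight ensures_bind_arith) (simp only: if_False)
  next
    case True
    have "ensures (arith (W - sum w G) \<bind> (\<lambda>W'. greedy E (marginal (value_oracle f) G) w W' \<bind>
        (\<lambda>A. value_oracle f (A \<union> G) \<bind> (\<lambda>x. value_oracle f S \<bind> (\<lambda>y. arith (y \<le> x) \<bind>
          (\<lambda>improves. enum_loop E (value_oracle f) w W Gs (if improves then A \<union> G else S)))))))
      (\<lambda>R t'. feasible E w W R \<and> f S \<le> f R \<and>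
        (\<forall>G\<in>set (G # Gs). sum w G \<le> W \<longrightarrow> v G \<le> f R) \<and>
        card G + (1 + t') \<le> length (G # Gs) * (k + 7))"
    proof (rule ensures_bind_arith, rule ensures_bind[OF Cons.prems(2)[OF list.set_intros(1) True]],
        intro ensures_bind_computes[OF computes_value_oracle] ensures_bind_arith, rule IH)
      fix A t
      assume A: "A \<subseteq> E \<and> sum w A \<le> W - sum w G \<and> t \<le> k \<and> v G \<le> f (A \<union> G)"
      let ?S = "if f S \<le> f (A \<union> G) then A \<union> G else S"
      \<comment> \<open>Only an inequality, since greedy runs on all of \<open>E\<close> and may
        select elements of \<open>G\<close> again.\<close>
      have "sum w (A \<union> G) \<le> sum w A + sum w G"
        using A GE fin by (metis finite_subset le_add1 sum.union_inter)
      then show "feasible E w W ?S"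
        using A GE True Cons.prems(3) by (auto simp: feasible_def)
      fix R t'
      assume "feasible E w W R \<and> f ?S \<le> f R \<and> (\<forall>G\<in>set Gs. sum w G \<le> W \<longrightarrow> v G \<le> f R) \<and>
        t' \<le> length Gs * (k + 7)"
      then show "feasible E w W R \<and> f S \<le> f R \<and>
        (\<forall>G\<in>set (G # Gs). sum w G \<le> W \<longrightarrow> v G \<le> f R) \<and>
        card G + (1 + (1 + (t + (1 + (1 + (1 + t')))))) \<le> length (G # Gs) * (k + 7)"
        using A cardG by (auto split: if_splits)
    qed auto
    with True show ?thesis
      unfolding enum_loop.simps
      by (intro ensures_bind_weight ensures_bind_arith) (simp only: if_True)
  qed
qed

section \<open>Number of guesses and assembly of the bounds\<close>

text \<open>Ordered pairs from \<open>E\<close> cover all sets of one or two elements, singletons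
  via \<open>x = y\<close>; the extra 1 is for the empty set.\<close>

lemma card_subsets_le_2:
  assumes "finite E"
  shows "card {G. G \<subseteq> E \<and> card G \<le> 2} \<le> card E ^ 2 + 1"
proof -
  have "{G. G \<subseteq> E \<and> card G \<le> 2} \<subseteq> insert {} ((\<lambda>(x, y). {x, y}) ` (E \<times> E))"
  proof
    fix G assume "G \<in> {G. G \<subseteq> E \<and> card G \<le> 2}"
    then have G: "G \<subseteq> E" "card G = 0 \<or> card G = 1 \<or> card G = 2" and "finite G"
      using assms finite_subset by auto
    then consider "G = {}" | x where "G = {x, x}" | x y where "G = {x, y}"
      by (auto simp: card_1_singleton_iff card_2_iff)
    then show "G \<in> insert {} ((\<lambda>(x, y). {x, y}) ` (E \<times> E))"
      using G(1) by cases auto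
  qed
  then have "card {G. G \<subseteq> E \<and> card G \<le> 2} \<le> card (insert {} ((\<lambda>(x, y). {x, y}) ` (E \<times> E)))"
    using assms by (intro card_mono) auto
  also have "\<dots> \<le> card ((\<lambda>(x, y). {x, y}) ` (E \<times> E)) + 1"
    using assms by (simp add: card_insert_if)
  also have "\<dots> \<le> card (E \<times> E) + 1"
    using assms by (intro add_right_mono card_image_le) auto
  finally show ?thesis
    by (simp add: card_cartesian_product power2_eq_square)
qed

lemma ensures_enum_greedy2:
  assumes msk: "msk_instance E f w W"
  shows "ensures (enum_greedy2 E (value_oracle f) w W)
    (\<lambda>S t. feasible E w W S \<and> (1 - exp (- 1)) * Max {f T | T. feasible E w W T} \<le> f S \<and>
      t \<le> (card E ^ 2 + 1) * (card E * (10 * card E + 1) + 7))"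
proof -
  let ?\<G> = "{G. G \<subseteq> E \<and> card G \<le> 2}" and ?F = "{f T | T. feasible E w W T}"
  from msk have fin: "finite E" and nonneg: "\<And>S. S \<subseteq> E \<Longrightarrow> 0 \<le> f S"
    by (auto simp: msk_instance_def)
  have empty: "feasible E w W {}"
    by (simp add: feasible_def)
  have "?F \<subseteq> f ` Pow E"
    by (auto simp: feasible_def)
  then have "finite ?F"
    using fin finite_subset by blast
  then have "Max ?F \<in> ?F"
    using empty by (intro Max_in) auto
  then obtain O' where O': "Max ?F = f O'" "feasible E w W O'"
    by auto
  obtain G0 where G0: "G0 \<subseteq> E" "card G0 \<le> 2" "sum w G0 \<le> W"
    and good: "ensures (greedy E (marginal (value_oracle f) G0) w (W - sum w G0))
      (\<lambda>A t. (1 - exp (- 1)) * f O' \<le> f (A \<union> G0))"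
    using exists_good_pair[OF msk O'(2)] .
  \<comment> \<open>Only the guess \<open>G0\<close> has to reach the target. Elsewhere the bound 0
    holds by non-negativity of \<open>f\<close>, which gives the uniform guarantee that the
    enumeration lemma expects.\<close>
  define v where "v = (\<lambda>G. if G = G0 then (1 - exp (- 1)) * f O' else 0)"
  have greedy: "ensures (greedy E (marginal (value_oracle f) G) w (W - sum w G))
      (\<lambda>A t. A \<subseteq> E \<and> sum w A \<le> W - sum w G \<and> t \<le> card E * (10 * card E + 1) \<and>
        v G \<le> f (A \<union> G))" if "G \<subseteq> E" for G
  proof (cases "G = G0")
    case True
    with ensures_conj[OF greedy_marginal_feasible_cost[OF fin] good] show ?thesis
      by (simp add: v_def conj_assoc)
  next
    case False
    with that show ?thesis
      by (intro ensures_mono[OF greedy_marginal_feasible_cost[OF fin]]) (auto simp: v_def nonneg)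
  qed
  have "finite ?\<G>"
    using fin by simp
  from finite_distinct_list[OF this] obtain l where "set l = ?\<G>" "distinct l"
    by (elim exE conjE)
  then have nonempty: "{Gs. distinct Gs \<and> set Gs = ?\<G>} \<noteq> {}"
    by auto
  show ?thesis
    unfolding enum_greedy2_def
  proof (rule ensures_bind[where P = "\<lambda>Gs t. distinct Gs \<and> set Gs = ?\<G> \<and> t = 0"])
    show "ensures (pick {Gs. distinct Gs \<and> set Gs = ?\<G>})
      (\<lambda>Gs t. distinct Gs \<and> set Gs = ?\<G> \<and> t = 0)"
      using nonempty by (intro ensures_pick) auto
    fix Gs t
    assume Gs: "distinct Gs \<and> set Gs = ?\<G> \<and> t = (0::nat)"
    then have "length Gs \<le> card E ^ 2 + 1"
      using card_subsets_le_2[OF fin] distinct_card[of Gs] by simp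
    then have len: "length Gs * (card E * (10 * card E + 1) + 7) \<le>
        (card E ^ 2 + 1) * (card E * (10 * card E + 1) + 7)"
      by (rule mult_right_mono) simp
    have "ensures (enum_loop E (value_oracle f) w W Gs {})
      (\<lambda>R t. feasible E w W R \<and> f {} \<le> f R \<and> (\<forall>G\<in>set Gs. sum w G \<le> W \<longrightarrow> v G \<le> f R) \<and>
        t \<le> length Gs * (card E * (10 * card E + 1) + 7))"
      using Gs by (intro ensures_enum_loop[OF fin _ greedy empty]) auto
    then show "ensures (enum_loop E (value_oracle f) w W Gs {})
      (\<lambda>S t'. feasible E w W S \<and> (1 - exp (- 1)) * Max ?F \<le> f S \<and>
        t + t' \<le> (card E ^ 2 + 1) * (card E * (10 * card E + 1) + 7))"
    proof (rule ensures_mono)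
      fix R t'
      assume R: "feasible E w W R \<and> f {} \<le> f R \<and>
        (\<forall>G\<in>set Gs. sum w G \<le> W \<longrightarrow> v G \<le> f R) \<and>
        t' \<le> length Gs * (card E * (10 * card E + 1) + 7)"
      have "G0 \<in> set Gs"
        using Gs G0 by blast
      with R G0(3) have "v G0 \<le> f R"
        by blast
      moreover have "t + t' \<le> (card E ^ 2 + 1) * (card E * (10 * card E + 1) + 7)"
        using R len Gs by linarith
      ultimately show "feasible E w W R \<and> (1 - exp (- 1)) * Max ?F \<le> f R \<and>
        t + t' \<le> (card E ^ 2 + 1) * (card E * (10 * card E + 1) + 7)"
        using R by (simp only: v_def O'(1) if_True refl simp_thms)
    qed
  qed
qed

theorem theorem1p1:
  "approximation_algorithm (1 - exp (- 1))
     (enum_greedy2 :: 'a set \<Rightarrow> ('a set \<Rightarrow> real comp) \<Rightarrow> ('a \<Rightarrow> nat) \<Rightarrow> nat \<Rightarrow> 'a set comp) \<and>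
   (\<exists>T. T \<in> O(\<lambda>n. real n ^ 4) \<and>
     cost_bound
       (enum_greedy2 :: 'a set \<Rightarrow> ('a set \<Rightarrow> real comp) \<Rightarrow> ('a \<Rightarrow> nat) \<Rightarrow> nat \<Rightarrow> 'a set comp) T)"
proof (intro conjI exI)
  show "approximation_algorithm (1 - exp (- 1))
     (enum_greedy2 :: 'a set \<Rightarrow> ('a set \<Rightarrow> real comp) \<Rightarrow> ('a \<Rightarrow> nat) \<Rightarrow> nat \<Rightarrow> 'a set comp)"
    unfolding approximation_algorithm_def
  proof (intro allI impI)
    fix E :: "'a set" and f w W
    assume "msk_instance E f w W"
    from ensures_enum_greedy2[OF this] show "runs (enum_greedy2 E (value_oracle f) w W) \<noteq> {} \<and>
      (\<forall>(S, q, a) \<in> runs (enum_greedy2 E (value_oracle f) w W).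
        feasible E w W S \<and> (1 - exp (- 1)) * Max {f T | T. feasible E w W T} \<le> f S)"
      unfolding ensures_def by blast
  qed
next
  \<comment> \<open>Quadratically many guesses, each with a quadratic greedy run.\<close>
  show "(\<lambda>n. (real n ^ 2 + 1) * (real n * (10 * real n + 1) + 7)) \<in> O(\<lambda>n. real n ^ 4)"
    by real_asymp
next
  show "cost_bound
      (enum_greedy2 :: 'a set \<Rightarrow> ('a set \<Rightarrow> real comp) \<Rightarrow> ('a \<Rightarrow> nat) \<Rightarrow> nat \<Rightarrow> 'a set comp)
      (\<lambda>n. (real n ^ 2 + 1) * (real n * (10 * real n + 1) + 7))"
    unfolding cost_bound_def
  proof (intro allI impI, clarify)
    fix E :: "'a set" and f w W S q a
    assume "msk_instance E f w W" and "(S, q, a) \<in> runs (enum_greedy2 E (value_oracle f) w W)"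
    with ensures_enum_greedy2[of E f w W]
    have "q + a \<le> (card E ^ 2 + 1) * (card E * (10 * card E + 1) + 7)"
      unfolding ensures_def by blast
    then have "real (q + a) \<le> real ((card E ^ 2 + 1) * (card E * (10 * card E + 1) + 7))"
      by (rule of_nat_mono)
    then show "real (q + a) \<le>
        (real (card E) ^ 2 + 1) * (real (card E) * (10 * real (card E) + 1) + 7)"
      by (simp only: of_nat_add of_nat_mult of_nat_power of_nat_1 of_nat_numeral)
  qed
qed

end
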